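(* Let $U\subseteq\mathbb{R}$ be an interval of infinite length, let $\{P_\eta:\eta\in U\}$ be an exponential family of distributions on $\mathbb{R}$ with range of natural parameters $U$, and let $I\subseteq U$ be any interval of positive length. Then for every real $\varepsilon\ge0$ and every integer $n\ge0$ there exists no $(\varepsilon,0)$-differentially private randomized algorithm $M:\mathbb{R}^n\to\mathbb{R}$ satisfying $\mathbb{E}_{X\leftarrow P_\eta^n,M}[M(X)]=\eta$ for all $\eta\in I$.
   Context: Exponential family (here with one-dimensional data and parameter): given $D\subseteq\mathbb{R}$, a carrier measure $h:D\to[0,\infty)$ and a sufficient statistic $T:D\to\mathbb{R}$, it is the collection of probability measures $P_\eta$ with density $f_\eta(x)=h(x)\exp(\eta T(x)-Z(\eta))$ on $D$, where $Z(\eta)=\ln\left(\int_Dh(x)\exp(\eta T(x))\,dx\right)$; it is defined over all $\eta\in\mathbb{R}$ with $Z(\eta)<\infty$, and the set $U$ of these values is its range of natural parameters. A randomized algorithm $M:\mathcal{X}^n\to\mathcal{Y}$ is $(\varepsilon,\delta)$-differentially private if for all datasets $x,x'\in\mathcal{X}^n$ differing in exactly one coordinate and all measurable $Y\subseteq\mathcal{Y}$, $\Pr[M(x)\in Y]\le e^{\varepsilon}\Pr[M(x')\in Y]+\delta$. $X\leftarrow P^n$ means $n$ i.i.d. samples from $P$; $\mathbb{E}_{X,M}$ is over $X$ and the independent internal randomness of $M$, and the equation $\mathbb{E}[M(X)]=\eta$ includes that $M(X)$ is integrable. *)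

theory Defs
  imports "HOL-Probability.Probability"
begin

text \<open>
  An exponential family is given by its support set \<open>D\<close>, carrier \<open>h\<close> and sufficient statistic \<open>T\<close>.
  The functions \<open>h\<close> and \<open>T\<close> are total in HOL; only their values on \<open>D\<close> matter below.
\<close>

definition partition_integral ::
    "real set \<Rightarrow> (real \<Rightarrow> real) \<Rightarrow> (real \<Rightarrow> real) \<Rightarrow> real \<Rightarrow> ennreal" where
  "partition_integral D h T \<eta> = (\<integral>\<^sup>+x\<in>D. ennreal (h x * exp (\<eta> * T x)) \<partial>lborel)"

text \<open>
  The logarithm of the partition integral in the extended reals, with \<open>ln 0 = -\<infinity>\<close> and
  \<open>ln \<infinity> = \<infinity>\<close>.
\<close>

definition log_partition ::
    "real set \<Rightarrow> (real \<Rightarrow> real) \<Rightarrow> (real \<Rightarrow> real) \<Rightarrow> real \<Rightarrow> ereal" where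
  "log_partition D h T \<eta> =
    (if partition_integral D h T \<eta> = \<infinity> then \<infinity>
     else if partition_integral D h T \<eta> = 0 then -\<infinity>
     else ereal (ln (enn2real (partition_integral D h T \<eta>))))"

definition natural_parameters ::
    "real set \<Rightarrow> (real \<Rightarrow> real) \<Rightarrow> (real \<Rightarrow> real) \<Rightarrow> real set" where
  "natural_parameters D h T = {\<eta>. log_partition D h T \<eta> < \<infinity>}"

text \<open>
  The condition that \<open>h\<close> does not vanish almost everywhere on \<open>D\<close> says that the partition integral
  is not zero, so that the members of the family are indeed probability measures.
\<close>

definition exponential_family ::
    "real set \<Rightarrow> (real \<Rightarrow> real) \<Rightarrow> (real \<Rightarrow> real) \<Rightarrow> bool" where
  "exponential_family D h T \<longleftrightarrow>
    D \<in> sets borel \<and>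
    h \<in> borel_measurable (restrict_space borel D) \<and>
    T \<in> borel_measurable (restrict_space borel D) \<and>
    (\<forall>x\<in>D. 0 \<le> h x) \<and>
    \<not> (AE x in lborel. x \<in> D \<longrightarrow> h x = 0)"

definition ef_density ::
    "real set \<Rightarrow> (real \<Rightarrow> real) \<Rightarrow> (real \<Rightarrow> real) \<Rightarrow> real \<Rightarrow> real \<Rightarrow> real" where
  "ef_density D h T \<eta> x = h x * exp (\<eta> * T x - real_of_ereal (log_partition D h T \<eta>))"

definition ef_measure ::
    "real set \<Rightarrow> (real \<Rightarrow> real) \<Rightarrow> (real \<Rightarrow> real) \<Rightarrow> real \<Rightarrow> real measure" where
  "ef_measure D h T \<eta> =
    density lborel (\<lambda>x. ennreal (ef_density D h T \<eta> x) * indicator D x)"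

text \<open>
  A dataset of size \<open>n\<close> is an element of \<open>space (Pi\<^sub>M {..<n} (\<lambda>_. A))\<close>, that is, a function which is
  \<open>undefined\<close> outside \<open>{..<n}\<close>. A randomized algorithm is a Markov kernel: it sends a dataset \<open>x\<close>
  to the probability distribution of its output on \<open>x\<close>.
\<close>

definition randomized_algorithm ::
    "nat \<Rightarrow> 'a measure \<Rightarrow> 'b measure \<Rightarrow> ((nat \<Rightarrow> 'a) \<Rightarrow> 'b measure) \<Rightarrow> bool" where
  "randomized_algorithm n A B M \<longleftrightarrow> M \<in> Pi\<^sub>M {..<n} (\<lambda>_. A) \<rightarrow>\<^sub>M prob_algebra B"

definition differentially_private ::
    "real \<Rightarrow> real \<Rightarrow> nat \<Rightarrow> 'a measure \<Rightarrow> 'b measure \<Rightarrow> ((nat \<Rightarrow> 'a) \<Rightarrow> 'b measure) \<Rightarrow> bool" where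
  "differentially_private \<epsilon> \<delta> n A B M \<longleftrightarrow>
    (\<forall>x \<in> space (Pi\<^sub>M {..<n} (\<lambda>_. A)). \<forall>x' \<in> space (Pi\<^sub>M {..<n} (\<lambda>_. A)).
      (\<exists>!i. i < n \<and> x i \<noteq> x' i) \<longrightarrow>
      (\<forall>Y \<in> sets B. measure (M x) Y \<le> exp \<epsilon> * measure (M x') Y + \<delta>))"

text \<open>The distribution of \<open>M X\<close>, where \<open>X\<close> consists of \<open>n\<close> independent samples from \<open>P\<close>.\<close>

definition output_distribution ::
    "nat \<Rightarrow> 'a measure \<Rightarrow> ((nat \<Rightarrow> 'a) \<Rightarrow> 'b measure) \<Rightarrow> 'b measure" where
  "output_distribution n P M = Pi\<^sub>M {..<n} (\<lambda>_. P) \<bind> M"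

text \<open>
  Integrability is required explicitly, since the Bochner integral of a non-integrable function
  is \<open>0\<close>.
\<close>

definition has_mean_output ::
    "nat \<Rightarrow> 'a measure \<Rightarrow> ((nat \<Rightarrow> 'a) \<Rightarrow> real measure) \<Rightarrow> real \<Rightarrow> bool" where
  "has_mean_output n P M m \<longleftrightarrow>
    integrable (output_distribution n P M) (\<lambda>y. y) \<and>
    (\<integral>y. y \<partial>output_distribution n P M) = m"

end

theory Submission
  imports Defs "HOL-Complex_Analysis.Conformal_Mappings"
begin

text \<open>
  Pure differential privacy bounds the mean of the algorithm uniformly over all datasets, while
  unbiasedness on a short interval of parameters propagates, by analytic continuation, to
  parameters of arbitrarily large modulus; a bounded estimator cannot be unbiased there.

  In more detail, suppose that \<open>M\<close> is private and unbiased on \<open>I\<close>. Any two datasets are joined by a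
  chain of at most \<open>n\<close> changes of a single coordinate, so the output distributions of \<open>M\<close> on any two
  datasets are within a factor \<open>exp (n * \<epsilon>)\<close> of each other as measures (\<open>group_privacy\<close>).
  Integrability of the output at one parameter gives one dataset on which \<open>M\<close> has a finite first
  absolute moment, and hence a single bound \<open>C\<close> on this moment for all datasets
  (\<open>private_output_moment_bound\<close>). So \<open>g x\<close>, the mean of \<open>M x\<close>, satisfies \<open>\<bar>g x\<bar> \<le> C\<close>, and the mean
  output under \<open>P\<^sub>\<eta>\<^sup>n\<close> is the expectation of \<open>g\<close>.

  The law \<open>P\<^sub>\<eta>\<^sup>n\<close> has density \<open>exp (\<eta> * S x) / W \<eta>\<close> with respect to a measure \<open>\<mu>\<close> that does not
  depend on \<open>\<eta>\<close>, where \<open>S x\<close> is the sum of the sufficient statistics of the samples and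
  \<open>W \<eta> = \<integral> exp (\<eta> * S) d\<mu>\<close> (\<open>exponential_family_product\<close>). Unbiasedness on \<open>I\<close> thus says that
  \<open>\<integral> g * exp (\<eta> * S) d\<mu> = \<eta> * W \<eta>\<close> for \<open>\<eta> \<in> I\<close>. Both sides are Laplace-type integrals and extend to
  holomorphic functions on the vertical strip over every open interval contained in \<open>U\<close>
  (\<open>holomorphic_exp_integral\<close>), so by the identity theorem they agree at every real \<open>t\<close> in such an
  interval that meets \<open>I\<close> in an
  interval of positive length. At that \<open>t\<close>, \<open>\<bar>t\<bar> * W t = \<bar>\<integral> g * exp (t * S) d\<mu>\<bar> \<le> C * W t\<close>
  and therefore \<open>\<bar>t\<bar> \<le> C\<close> (\<open>bounded_unbiased_estimator_imp_bounded_parameter\<close>). Since \<open>U\<close> has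
  infinite length, some such \<open>t\<close> has \<open>\<bar>t\<bar> > C\<close>.
\<close>

section \<open>Holomorphy of Laplace-type integrals\<close>

lemma strip_open_connected:
  "open {z. c < Re z \<and> Re z < d}" "connected {z. c < Re z \<and> Re z < d}"
proof -
  have eq: "{z. c < Re z \<and> Re z < d} = {z. c < Re z} \<inter> {z. Re z < d}" by auto
  show "open {z. c < Re z \<and> Re z < d}"
    unfolding eq by (intro open_Int open_halfspace_Re_gt open_halfspace_Re_lt)
  show "connected {z. c < Re z \<and> Re z < d}"
    unfolding eq by (intro convex_connected convex_Int convex_halfspace_Re_gt convex_halfspace_Re_lt)
qed

text \<open>
  The derivative \<open>s * exp (u * s)\<close> on the ball of radius \<open>r\<close> has modulus at most
  \<open>\<bar>s\<bar> * exp (Re z * s + r * \<bar>s\<bar>)\<close>. The factor \<open>\<bar>s\<bar>\<close> is absorbed into \<open>exp (r * \<bar>s\<bar>) / r\<close>, which turns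
  \<open>r\<close> into \<open>2 * r\<close>, and the remaining \<open>exp (Re z * s + 2 * r * \<bar>s\<bar>)\<close> is one of the two exponentials
  in the bound, depending on the sign of \<open>s\<close>. This bound does not depend on \<open>w\<close>, and its integral
  against \<open>g\<close> is finite as soon as \<open>Re z \<plusminus> 2 * r\<close> are admissible exponents.
\<close>

lemma exp_difference_quotient_bound:
  fixes z w :: complex and s r :: real
  assumes r: "0 < r" and w: "w \<in> ball z r" "w \<noteq> z"
  shows "cmod ((exp (w * of_real s) - exp (z * of_real s)) / (w - z))
    \<le> (exp ((Re z + 2 * r) * s) + exp ((Re z - 2 * r) * s)) / r"
proof -
  have "cmod (exp (w * of_real s) - exp (z * of_real s))
      \<le> (\<bar>s\<bar> * exp (Re z * s + r * \<bar>s\<bar>)) * cmod (w - z)"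
  proof (rule field_differentiable_bound[where S = "ball z r"
        and f' = "\<lambda>u. exp (u * of_real s) * of_real s"])
    fix u assume u: "u \<in> ball z r"
    show "((\<lambda>u. exp (u * of_real s)) has_field_derivative exp (u * of_real s) * of_real s)
        (at u within ball z r)"
      by (auto intro!: derivative_eq_intros)
    have "\<bar>Re u - Re z\<bar> \<le> r"
      using u abs_Re_le_cmod[of "u - z"] by (simp add: dist_norm norm_minus_commute)
    then have "(Re u - Re z) * s \<le> r * \<bar>s\<bar>"
      by (metis abs_ge_self abs_ge_zero abs_mult mult_right_mono order_trans)
    then show "cmod (exp (u * of_real s) * of_real s) \<le> \<bar>s\<bar> * exp (Re z * s + r * \<bar>s\<bar>)"
      by (simp add: norm_mult algebra_simps mult_left_mono)
  qed (use r w in auto)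
  then have "cmod ((exp (w * of_real s) - exp (z * of_real s)) / (w - z))
      \<le> \<bar>s\<bar> * exp (Re z * s + r * \<bar>s\<bar>)"
    using w by (simp add: norm_divide divide_le_eq)
  also have "\<dots> \<le> exp (r * \<bar>s\<bar>) / r * exp (Re z * s + r * \<bar>s\<bar>)"
  proof (rule mult_right_mono)
    have "r * \<bar>s\<bar> \<le> exp (r * \<bar>s\<bar>)"
      using exp_ge_add_one_self[of "r * \<bar>s\<bar>"] by linarith
    then show "\<bar>s\<bar> \<le> exp (r * \<bar>s\<bar>) / r" using r by (simp add: field_simps)
  qed simp
  also have "\<dots> = exp (Re z * s + 2 * r * \<bar>s\<bar>) / r"
    by (simp add: exp_add[symmetric] algebra_simps)
  also have "\<dots> \<le> (exp ((Re z + 2 * r) * s) + exp ((Re z - 2 * r) * s)) / r"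
    using r by (cases "0 \<le> s") (auto simp: divide_le_cancel algebra_simps)
  finally show ?thesis .
qed

text \<open>
  Differentiation under the integral sign: the difference quotients of the integrand converge
  pointwise and are dominated on a small ball around each point of the strip, by
  \<open>exp_difference_quotient_bound\<close>.
\<close>

lemma holomorphic_exp_integral:
  fixes g S :: "'a \<Rightarrow> real"
  assumes [measurable]: "g \<in> borel_measurable \<mu>" "S \<in> borel_measurable \<mu>"
    and int: "\<And>t. c < t \<Longrightarrow> t < d \<Longrightarrow> integrable \<mu> (\<lambda>x. g x * exp (t * S x))"
  shows "(\<lambda>z. \<integral>x. of_real (g x) * exp (z * of_real (S x)) \<partial>\<mu>)
    holomorphic_on {z. c < Re z \<and> Re z < d}"
proof -
  let ?S = "{z. c < Re z \<and> Re z < d}"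
  let ?e = "\<lambda>z x. complex_of_real (g x) * exp (z * of_real (S x))"
  have intC: "integrable \<mu> (?e z)" if "z \<in> ?S" for z
    by (rule Bochner_Integration.integrable_bound[OF int[of "Re z"]])
       (use that in \<open>auto simp: norm_mult abs_mult\<close>)
  have "\<exists>D. ((\<lambda>z. integral\<^sup>L \<mu> (?e z)) has_field_derivative D) (at z)" if z: "z \<in> ?S" for z
  proof -
    \<comment> \<open>A third of the distance to the boundary leaves room for the exponents \<open>Re z \<plusminus> 2 * r\<close>.\<close>
    define r where "r = min (Re z - c) (d - Re z) / 3"
    have r: "0 < r" "c < Re z - 2 * r" "Re z + 2 * r < d"
      using z by (auto simp: r_def min_def field_simps)
    have ball: "ball z r \<subseteq> ?S"
    proof
      fix w assume "w \<in> ball z r"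
      then have "\<bar>Re w - Re z\<bar> < r"
        using abs_Re_le_cmod[of "w - z"] by (simp add: dist_norm norm_minus_commute)
      then show "w \<in> ?S" using r by auto
    qed
    define q where "q = (\<lambda>w x. (?e w x - ?e z x) / (w - z))"
    define D where "D = (\<integral>x. ?e z x * of_real (S x) \<partial>\<mu>)"
    have lim: "((\<lambda>w. integral\<^sup>L \<mu> (q w)) \<longlongrightarrow> D) (at z)"
      unfolding tendsto_at_iff_sequentially
    proof (intro allI impI)
      fix X assume X: "\<forall>i. X i \<in> UNIV - {z}" "X \<longlonglongrightarrow> z"
      \<comment> \<open>The dominating function is only valid inside the ball, so the first terms are dropped.\<close>
      obtain N where N: "\<And>i. i \<ge> N \<Longrightarrow> X i \<in> ball z r"
        using X(2) r(1) unfolding lim_sequentially by (metis dist_commute mem_ball)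
      have "(\<lambda>i. integral\<^sup>L \<mu> (q (X (i + N)))) \<longlonglongrightarrow> D"
        unfolding D_def
      proof (rule integral_dominated_convergence)
        let ?w = "\<lambda>x. (norm (g x * exp ((Re z + 2 * r) * S x))
          + norm (g x * exp ((Re z - 2 * r) * S x))) / r"
        show "integrable \<mu> ?w"
          by (intro integrable_divide_zero Bochner_Integration.integrable_add integrable_norm int)
            (use r in auto)
        show "AE x in \<mu>. (\<lambda>i. q (X (i + N)) x) \<longlonglongrightarrow> ?e z x * of_real (S x)"
        proof (rule AE_I2)
          fix x
          have "((\<lambda>w. ?e w x) has_field_derivative ?e z x * of_real (S x)) (at z)"
            by (auto intro!: derivative_eq_intros)
          then have "((\<lambda>w. q w x) \<longlongrightarrow> ?e z x * of_real (S x)) (at z)"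
            unfolding has_field_derivative_iff q_def .
          then have "((\<lambda>w. q w x) \<circ> X) \<longlonglongrightarrow> ?e z x * of_real (S x)"
            using X unfolding tendsto_at_iff_sequentially by blast
          then show "(\<lambda>i. q (X (i + N)) x) \<longlonglongrightarrow> ?e z x * of_real (S x)"
            unfolding comp_def by (rule LIMSEQ_ignore_initial_segment)
        qed
        show "AE x in \<mu>. cmod (q (X (i + N)) x) \<le> ?w x" for i
        proof (rule AE_I2)
          fix x
          let ?w = "X (i + N)"
          have "cmod (q ?w x)
              = \<bar>g x\<bar> * cmod ((exp (?w * of_real (S x)) - exp (z * of_real (S x))) / (?w - z))"
            by (simp add: q_def norm_divide norm_mult right_diff_distrib[symmetric])
          also have "\<dots> \<le> \<bar>g x\<bar> * ((exp ((Re z + 2 * r) * S x) + exp ((Re z - 2 * r) * S x)) / r)"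
            by (intro mult_left_mono exp_difference_quotient_bound) (use r N X in auto)
          finally show "cmod (q ?w x) \<le> (norm (g x * exp ((Re z + 2 * r) * S x))
              + norm (g x * exp ((Re z - 2 * r) * S x))) / r"
            by (simp add: abs_mult algebra_simps)
        qed
      qed (auto simp: q_def)
      then show "((\<lambda>w. integral\<^sup>L \<mu> (q w)) \<circ> X) \<longlonglongrightarrow> D"
        unfolding comp_def by (rule LIMSEQ_offset)
    qed
    have "\<forall>\<^sub>F w in at z. integral\<^sup>L \<mu> (q w)
        = (integral\<^sup>L \<mu> (?e w) - integral\<^sup>L \<mu> (?e z)) / (w - z)"
      using eventually_at_ball[OF r(1)]
    proof eventually_elim
      case (elim w)
      then have "w \<in> ?S" using ball by auto
      with z show ?case
        by (auto simp: q_def intC simp del: times_divide_eq_left times_divide_eq_right)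
    qed
    then have "((\<lambda>z. integral\<^sup>L \<mu> (?e z)) has_field_derivative D) (at z)"
      unfolding has_field_derivative_iff using lim by (simp cong: tendsto_cong)
    then show ?thesis by blast
  qed
  then show ?thesis
    using holomorphic_on_open[OF strip_open_connected(1)] by blast
qed

section \<open>Bounded unbiased estimators\<close>

lemma exp_integral_of_real:
  fixes g S :: "'a \<Rightarrow> real"
  shows "(\<integral>x. complex_of_real (g x) * exp (of_real t * of_real (S x)) \<partial>\<mu>)
    = of_real (\<integral>x. g x * exp (t * S x) \<partial>\<mu>)"
  by (simp only: exp_of_real of_real_mult[symmetric] integral_complex_of_real)

text \<open>
  With \<open>\<mu>\<close> weighted by \<open>exp (t * S) / \<integral> exp (t * S) d\<mu>\<close>, the hypothesis on \<open>{a<..<b}\<close> states that \<open>g\<close>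
  is an unbiased estimator of \<open>t\<close>. The identity theorem extends this to the whole of \<open>{c<..<d}\<close>,
  where the mean of \<open>g\<close> stays bounded by \<open>C\<close>.
\<close>

lemma bounded_unbiased_estimator_imp_bounded_parameter:
  fixes g S :: "'a \<Rightarrow> real"
  assumes [measurable]: "g \<in> borel_measurable \<mu>" "S \<in> borel_measurable \<mu>"
    and bound: "\<And>x. x \<in> space \<mu> \<Longrightarrow> \<bar>g x\<bar> \<le> C"
    and int: "\<And>t. t \<in> {c<..<d} \<Longrightarrow> integrable \<mu> (\<lambda>x. exp (t * S x))"
    and pos: "\<And>t. t \<in> {c<..<d} \<Longrightarrow> 0 < (\<integral>x. exp (t * S x) \<partial>\<mu>)"
    and ab: "a < b" "{a<..<b} \<subseteq> {c<..<d}"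
    and eq: "\<And>t. t \<in> {a<..<b} \<Longrightarrow>
      (\<integral>x. g x * exp (t * S x) \<partial>\<mu>) = t * (\<integral>x. exp (t * S x) \<partial>\<mu>)"
    and t: "t \<in> {c<..<d}"
  shows "\<bar>t\<bar> \<le> C"
proof -
  let ?S = "{z. c < Re z \<and> Re z < d}"
  \<comment> \<open>The factor 1 makes \<open>?W\<close> a literal instance of \<open>holomorphic_exp_integral\<close>.\<close>
  let ?W = "\<lambda>z. \<integral>x. complex_of_real 1 * exp (z * of_real (S x)) \<partial>\<mu>"
  let ?F = "\<lambda>z. \<integral>x. complex_of_real (g x) * exp (z * of_real (S x)) \<partial>\<mu>"
  have intg: "integrable \<mu> (\<lambda>x. g x * exp (t * S x))" if "t \<in> {c<..<d}" for t
  proof (rule Bochner_Integration.integrable_bound)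
    show "integrable \<mu> (\<lambda>x. C * exp (t * S x))" using int[OF that] by simp
    show "AE x in \<mu>. norm (g x * exp (t * S x)) \<le> norm (C * exp (t * S x))"
      using bound by (intro AE_I2) (force simp: abs_mult)
  qed simp
  have hol: "(\<lambda>z. ?F z - z * ?W z) holomorphic_on ?S"
    using intg int by (intro holomorphic_intros holomorphic_exp_integral) auto
  define m where "m = (a + b) / 2"
  have m: "m \<in> {a<..<b}" using ab by (simp add: m_def)
  have val: "?F (of_real s) - of_real s * ?W (of_real s)
      = of_real ((\<integral>x. g x * exp (s * S x) \<partial>\<mu>) - s * (\<integral>x. exp (s * S x) \<partial>\<mu>))" for s
    by (simp only: exp_integral_of_real[where g = g] exp_integral_of_real[where g = "\<lambda>_. 1"]
        mult_1 of_real_mult of_real_diff)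
  have "of_real m islimpt (complex_of_real ` {a<..<b})"
  proof -
    have "m islimpt {a<..<b}" using m by (intro interior_limit_point) simp
    then show ?thesis
      unfolding islimpt_sequential
      by (fastforce intro!: tendsto_of_real simp: image_iff)
  qed
  then have "?F (of_real t) - of_real t * ?W (of_real t) = 0"
  proof (rule analytic_continuation[OF hol strip_open_connected, rotated 2])
    fix z assume "z \<in> complex_of_real ` {a<..<b}"
    then obtain s where "z = of_real s" "s \<in> {a<..<b}" by blast
    then show "?F z - z * ?W z = 0"
      using eq[of s] by (simp only: val) simp
  qed (use ab t m in auto)
  then have Ft: "(\<integral>x. g x * exp (t * S x) \<partial>\<mu>) = t * (\<integral>x. exp (t * S x) \<partial>\<mu>)"
    by (simp only: val of_real_eq_0_iff right_minus_eq)
  have "\<bar>t\<bar> * (\<integral>x. exp (t * S x) \<partial>\<mu>) = \<bar>\<integral>x. g x * exp (t * S x) \<partial>\<mu>\<bar>"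
    using pos[OF t] by (simp add: Ft abs_mult)
  also have "\<dots> \<le> (\<integral>x. \<bar>g x * exp (t * S x)\<bar> \<partial>\<mu>)"
    by (rule integral_abs_bound)
  also have "\<dots> \<le> (\<integral>x. C * exp (t * S x) \<partial>\<mu>)"
    using integrable_abs[OF intg[OF t]] int[OF t] bound by (intro integral_mono) (auto simp: abs_mult mult_right_mono)
  also have "\<dots> = C * (\<integral>x. exp (t * S x) \<partial>\<mu>)" by simp
  finally show ?thesis using pos[OF t] by (simp add: mult_le_cancel_right)
qed

section \<open>Private algorithms have uniformly bounded moments\<close>

text \<open>
  Replacing the coordinates of \<open>x\<close> by those of \<open>x'\<close> one at a time costs a factor \<open>exp \<epsilon>\<close> for each
  coordinate that actually changes, and there are at most \<open>n\<close> of them.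
\<close>

lemma group_privacy:
  assumes dp: "differentially_private \<epsilon> 0 n A B M" and "0 \<le> \<epsilon>"
    and x: "x \<in> space (Pi\<^sub>M {..<n} (\<lambda>_. A))" and x': "x' \<in> space (Pi\<^sub>M {..<n} (\<lambda>_. A))"
    and Y: "Y \<in> sets B"
  shows "measure (M x) Y \<le> exp (real n * \<epsilon>) * measure (M x') Y"
proof -
  define z where "z k = (\<lambda>i. if i < k then x' i else x i)" for k
  have "measure (M x) Y \<le> exp (real k * \<epsilon>) * measure (M (z k)) Y" if "k \<le> n" for k
    using that
  proof (induction k)
    case 0
    show ?case by (simp add: z_def)
  next
    case (Suc k)
    have sp: "z j \<in> space (Pi\<^sub>M {..<n} (\<lambda>_. A))" if "j \<le> n" for j
      using x x' that by (auto simp: z_def space_PiM PiE_iff extensional_def)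
    have step: "measure (M (z k)) Y \<le> exp \<epsilon> * measure (M (z (Suc k))) Y"
    proof (cases "x k = x' k")
      case True
      then have "z (Suc k) = z k" by (auto simp: z_def less_Suc_eq)
      then show ?thesis using \<open>0 \<le> \<epsilon>\<close> by (simp add: mult_le_cancel_right1 not_less)
    next
      case False
      then have "\<exists>!i. i < n \<and> z k i \<noteq> z (Suc k) i"
        using Suc.prems by (intro ex1I[of _ k]) (auto simp: z_def less_Suc_eq split: if_splits)
      from dp[unfolded differentially_private_def, rule_format, OF sp sp this Y] Suc.prems
      show ?thesis by simp
    qed
    have "measure (M x) Y \<le> exp (real k * \<epsilon>) * measure (M (z k)) Y"
      using Suc by simp
    also have "\<dots> \<le> exp (real k * \<epsilon>) * (exp \<epsilon> * measure (M (z (Suc k))) Y)"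
      using step by (intro mult_left_mono) auto
    also have "\<dots> = exp (real (Suc k) * \<epsilon>) * measure (M (z (Suc k))) Y"
      by (simp add: exp_add algebra_simps)
    finally show ?case .
  qed
  moreover have "z n = x'"
    using x x' by (auto simp: z_def space_PiM PiE_iff extensional_def fun_eq_iff)
  ultimately show ?thesis by (metis order_refl)
qed

lemma nn_integral_le_of_measure_le:
  assumes "sets N = sets M" "0 \<le> c" "finite_measure M" "finite_measure N"
    and le: "\<And>Y. Y \<in> sets M \<Longrightarrow> measure M Y \<le> c * measure N Y"
    and f: "f \<in> borel_measurable M"
  shows "(\<integral>\<^sup>+y. f y \<partial>M) \<le> ennreal c * (\<integral>\<^sup>+y. f y \<partial>N)"
proof -
  have [simp]: "space N = space M" using assms(1) by (rule sets_eq_imp_space_eq)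
  have fN: "f \<in> borel_measurable N" using f assms(1) by (simp cong: measurable_cong_sets)
  have "M \<le> scale_measure (ennreal c) N"
    using assms le
    by (subst le_measure) (auto simp: finite_measure.emeasure_eq_measure ennreal_mult'[symmetric])
  then have "(\<integral>\<^sup>+y. f y \<partial>M) \<le> (\<integral>\<^sup>+y. f y \<partial>scale_measure (ennreal c) N)"
    using assms by (intro nn_integral_mono_measure) auto
  also have "\<dots> = ennreal c * (\<integral>\<^sup>+y. f y \<partial>N)"
    using fN by (rule nn_integral_scale_measure)
  finally show ?thesis .
qed

text \<open>
  A mixture with an integrable output has a component with a finite first absolute moment, and
  group privacy transfers the moment of that component to every dataset.
\<close>

lemma private_output_moment_bound:
  assumes alg: "randomized_algorithm n A borel M"
    and dp: "differentially_private \<epsilon> 0 n A borel M" and "0 \<le> \<epsilon>"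
    and P: "prob_space P" "sets P = sets (Pi\<^sub>M {..<n} (\<lambda>_. A))"
    and int: "integrable (P \<bind> M) (\<lambda>y :: real. y)"
  obtains C where "\<And>x. x \<in> space (Pi\<^sub>M {..<n} (\<lambda>_. A)) \<Longrightarrow> (\<integral>\<^sup>+y. ennreal \<bar>y\<bar> \<partial>M x) \<le> ennreal C"
    "0 \<le> C"
proof -
  interpret prob_space P by (rule P(1))
  have spP: "space P = space (Pi\<^sub>M {..<n} (\<lambda>_. A))" using P(2) by (rule sets_eq_imp_space_eq)
  have K[measurable]: "M \<in> Pi\<^sub>M {..<n} (\<lambda>_. A) \<rightarrow>\<^sub>M prob_algebra borel"
    using alg by (simp add: randomized_algorithm_def)
  have M: "prob_space (M x)" "sets (M x) = sets borel" if "x \<in> space P" for x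
    using measurable_space[OF K, of x] that by (auto simp: spP space_prob_algebra)
  have KP[measurable]: "M \<in> P \<rightarrow>\<^sub>M subprob_algebra borel"
    using measurable_prob_algebraD[OF K] by (simp add: measurable_cong_sets[OF P(2) refl])
  have "(\<integral>\<^sup>+x. (\<integral>\<^sup>+y. ennreal \<bar>y\<bar> \<partial>M x) \<partial>P) = (\<integral>\<^sup>+y. ennreal \<bar>y\<bar> \<partial>(P \<bind> M))"
    by (rule nn_integral_bind[where B = borel, symmetric]) auto
  also have "\<dots> < \<infinity>" using int by (simp add: integrable_iff_bounded)
  finally have "AE x in P. (\<integral>\<^sup>+y. ennreal \<bar>y\<bar> \<partial>M x) \<noteq> \<infinity>"
    by (intro nn_integral_PInf_AE) auto
  with AE_space have "AE x in P. x \<in> space P \<and> (\<integral>\<^sup>+y. ennreal \<bar>y\<bar> \<partial>M x) \<noteq> \<infinity>"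
    by eventually_elim simp
  then have "ae_filter P = bot \<or> (\<exists>x. x \<in> space P \<and> (\<integral>\<^sup>+y. ennreal \<bar>y\<bar> \<partial>M x) \<noteq> \<infinity>)"
    by (rule eventually_happens)
  then obtain x0 where x0: "x0 \<in> space P" "(\<integral>\<^sup>+y. ennreal \<bar>y\<bar> \<partial>M x0) \<noteq> \<infinity>"
    by (auto simp: ae_filter_eq_bot_iff emeasure_space_1)
  define C where "C = exp (real n * \<epsilon>) * enn2real (\<integral>\<^sup>+y. ennreal \<bar>y\<bar> \<partial>M x0)"
  show ?thesis
  proof (rule that[of C])
    show "0 \<le> C" by (simp add: C_def)
    fix x assume "x \<in> space (Pi\<^sub>M {..<n} (\<lambda>_. A))"
    then have x: "x \<in> space P" by (simp add: spP)
    have "(\<integral>\<^sup>+y. ennreal \<bar>y\<bar> \<partial>M x) \<le> ennreal (exp (real n * \<epsilon>)) * (\<integral>\<^sup>+y. ennreal \<bar>y\<bar> \<partial>M x0)"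
    proof (rule nn_integral_le_of_measure_le)
      fix Y assume "Y \<in> sets (M x)"
      then show "measure (M x) Y \<le> exp (real n * \<epsilon>) * measure (M x0) Y"
        using x x0 M by (intro group_privacy[OF dp \<open>0 \<le> \<epsilon>\<close>]) (auto simp: spP)
    qed (use M x x0 in \<open>auto simp: prob_space_def cong: measurable_cong_sets\<close>)
    also have "\<dots> = ennreal C"
      using x0(2) by (simp add: C_def ennreal_mult' less_top)
    finally show "(\<integral>\<^sup>+y. ennreal \<bar>y\<bar> \<partial>M x) \<le> ennreal C" .
  qed
qed

text \<open>
  The law of total expectation for an unbounded output. It is reduced to the law for
  nonnegative functions, applied to the positive and the negative part, which are treated
  together as \<open>s * y\<close> with \<open>s\<close> equal to 1 or -1: \<^const>\<open>ennreal\<close> truncates negative reals to 0.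
\<close>

lemma integral_bind_of_finite_mean:
  fixes K :: "'a \<Rightarrow> real measure"
  assumes P: "prob_space P" and K: "K \<in> P \<rightarrow>\<^sub>M subprob_algebra borel"
    and fin: "\<And>x. x \<in> space P \<Longrightarrow> (\<integral>\<^sup>+y. ennreal \<bar>y\<bar> \<partial>K x) < \<infinity>"
    and int: "integrable (P \<bind> K) (\<lambda>y. y)"
  shows "(\<integral>y. y \<partial>(P \<bind> K)) = (\<integral>x. (\<integral>y. y \<partial>K x) \<partial>P)"
proof -
  interpret prob_space P by (rule P)
  note [measurable] = K
  define a where "a s x = (\<integral>\<^sup>+y. ennreal (s * y) \<partial>K x)" for s x
  have sK: "sets (K x) = sets borel" if "x \<in> space P" for x
    using that K by (rule sets_kernel[rotated])
  have am[measurable]: "a s \<in> borel_measurable P" for s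
    unfolding a_def by measurable
  have ale: "a s x < \<infinity>" if "x \<in> space P" "\<bar>s\<bar> = 1" for s x
  proof -
    have "a s x \<le> (\<integral>\<^sup>+y. ennreal \<bar>y\<bar> \<partial>K x)"
      unfolding a_def using that by (intro nn_integral_mono ennreal_leI) (metis abs_ge_self abs_mult mult_1)
    with fin[OF that(1)] show ?thesis by (rule le_less_trans[rotated])
  qed
  have nn: "(\<integral>\<^sup>+y. ennreal (s * y) \<partial>(P \<bind> K)) = (\<integral>\<^sup>+x. a s x \<partial>P)" for s
    unfolding a_def by (rule nn_integral_bind[where B = borel]) auto
  have nn': "(\<integral>\<^sup>+x. a s x \<partial>P) = (\<integral>\<^sup>+x. ennreal (enn2real (a s x)) \<partial>P)" if "\<bar>s\<bar> = 1" for s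
    using ale that by (intro nn_integral_cong) (auto simp: less_top)
  have fin1: "(\<integral>\<^sup>+x. a s x \<partial>P) < \<infinity>" if "\<bar>s\<bar> = 1" for s
    using int that unfolding real_integrable_def nn[symmetric]
    by (auto simp: abs_if less_top split: if_splits)
  have ia: "integrable P (\<lambda>x. enn2real (a s x))" if "\<bar>s\<bar> = 1" for s
    using fin1[OF that] nn'[OF that] by (intro integrableI_nonneg) auto
  have ea: "enn2real (\<integral>\<^sup>+x. a s x \<partial>P) = (\<integral>x. enn2real (a s x) \<partial>P)" if "\<bar>s\<bar> = 1" for s
    unfolding nn'[OF that] by (subst integral_eq_nn_integral) auto
  have "(\<integral>y. y \<partial>(P \<bind> K)) = enn2real (\<integral>\<^sup>+x. a 1 x \<partial>P) - enn2real (\<integral>\<^sup>+x. a (-1) x \<partial>P)"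
    unfolding nn[symmetric] using real_lebesgue_integral_def[OF int] by simp
  also have "\<dots> = (\<integral>x. enn2real (a 1 x) - enn2real (a (-1) x) \<partial>P)"
    using ia by (simp add: ea)
  also have "\<dots> = (\<integral>x. (\<integral>y. y \<partial>K x) \<partial>P)"
  proof (rule Bochner_Integration.integral_cong[OF refl])
    fix x assume x: "x \<in> space P"
    have "integrable (K x) (\<lambda>y. y)"
      using fin[OF x] sK[OF x] by (simp add: integrable_iff_bounded cong: measurable_cong_sets)
    then show "enn2real (a 1 x) - enn2real (a (-1) x) = (\<integral>y. y \<partial>K x)"
      by (simp add: real_lebesgue_integral_def a_def)
  qed
  finally show ?thesis .
qed

section \<open>Samples from an exponential family\<close>

text \<open>
  Both sides give a box the product of the integrals of \<open>f i\<close> over its sides.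
\<close>

lemma PiM_density:
  assumes "finite I" and M: "\<And>i. sigma_finite_measure (M i)"
    and f: "\<And>i. f i \<in> borel_measurable (M i)"
    and fM: "\<And>i. sigma_finite_measure (density (M i) (f i))"
  shows "Pi\<^sub>M I (\<lambda>i. density (M i) (f i)) = density (Pi\<^sub>M I M) (\<lambda>x. \<Prod>i\<in>I. f i (x i))"
proof -
  interpret M: product_sigma_finite M by (simp add: product_sigma_finite_def M)
  interpret D: product_sigma_finite "\<lambda>i. density (M i) (f i)"
    by (simp add: product_sigma_finite_def fM)
  note [measurable] = f
  note \<open>finite I\<close>[simp]
  show ?thesis
  proof (rule D.PiM_eqI[symmetric])
    show "sets (density (Pi\<^sub>M I M) (\<lambda>x. \<Prod>i\<in>I. f i (x i))) = sets (Pi\<^sub>M I (\<lambda>i. density (M i) (f i)))"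
      by (simp cong: sets_PiM_cong)
    fix A assume "\<And>i. i \<in> I \<Longrightarrow> A i \<in> sets (density (M i) (f i))"
    then have A: "\<And>i. i \<in> I \<Longrightarrow> A i \<in> sets (M i)" by simp
    have PiE_A: "Pi\<^sub>E I A \<in> sets (Pi\<^sub>M I M)" using A by (intro sets_PiM_I_finite) auto
    have "emeasure (density (Pi\<^sub>M I M) (\<lambda>x. \<Prod>i\<in>I. f i (x i))) (Pi\<^sub>E I A)
        = (\<integral>\<^sup>+x. (\<Prod>i\<in>I. f i (x i)) * indicator (Pi\<^sub>E I A) x \<partial>Pi\<^sub>M I M)"
      using PiE_A by (intro emeasure_density) auto
    also have "\<dots> = (\<integral>\<^sup>+x. (\<Prod>i\<in>I. f i (x i) * indicator (A i) (x i)) \<partial>Pi\<^sub>M I M)"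
    proof (rule nn_integral_cong)
      fix x assume "x \<in> space (Pi\<^sub>M I M)"
      then have "indicator (Pi\<^sub>E I A) x = (\<Prod>i\<in>I. indicator (A i) (x i) :: ennreal)"
        by (auto simp: indicator_def PiE_iff space_PiM prod_zero_iff)
      then show "(\<Prod>i\<in>I. f i (x i)) * indicator (Pi\<^sub>E I A) x = (\<Prod>i\<in>I. f i (x i) * indicator (A i) (x i))"
        by (simp add: prod.distrib)
    qed
    also have "\<dots> = (\<Prod>i\<in>I. \<integral>\<^sup>+y. f i y * indicator (A i) y \<partial>M i)"
      using A by (intro M.product_nn_integral_prod) auto
    also have "\<dots> = (\<Prod>i\<in>I. emeasure (density (M i) (f i)) (A i))"
      using A by (intro prod.cong refl emeasure_density[symmetric]) auto
    finally show "emeasure (density (Pi\<^sub>M I M) (\<lambda>x. \<Prod>i\<in>I. f i (x i))) (Pi\<^sub>E I A)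
        = (\<Prod>i\<in>I. emeasure (density (M i) (f i)) (A i))" .
  qed simp
qed


text \<open>
  The carrier \<open>h\<close> is absorbed into the reference measure \<open>\<nu>\<close>, which leaves a density that is the
  exponential of a linear function of \<open>\<eta>\<close>, up to normalisation. Since \<open>h\<close> and \<open>T\<close> are measurable
  only on \<open>D\<close>, they are replaced by their extensions by 0, which are measurable everywhere; the
  reference measure does not charge the complement of \<open>D\<close>.
\<close>

lemma exponential_family_wrt_carrier:
  assumes ef: "exponential_family D h T"
  obtains \<nu> :: "real measure" and S :: "real \<Rightarrow> real" where
    "sets \<nu> = sets borel" "S \<in> borel_measurable borel" "sigma_finite_measure \<nu>"
    "\<And>\<eta>. \<eta> \<in> natural_parameters D h T \<Longrightarrow>
      \<exists>Z>0. ef_measure D h T \<eta> = density \<nu> (\<lambda>x. ennreal (exp (\<eta> * S x) / Z)) \<and>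
        prob_space (ef_measure D h T \<eta>)"
proof -
  have D[measurable]: "D \<in> sets borel" and h0: "\<And>x. x \<in> D \<Longrightarrow> 0 \<le> h x"
    using ef by (auto simp: exponential_family_def)
  define k where "k x = indicator D x *\<^sub>R h x" for x
  define S where "S x = indicator D x *\<^sub>R T x" for x
  define \<nu> where "\<nu> = density lborel (\<lambda>x. ennreal (k x))"
  have [measurable]: "k \<in> borel_measurable borel" "S \<in> borel_measurable borel"
    using ef unfolding exponential_family_def k_def S_def
    by (auto simp: borel_measurable_restrict_space_iff)
  have k0: "0 \<le> k x" for x using h0 by (simp add: k_def indicator_def)
  have Z: "partition_integral D h T \<eta> = (\<integral>\<^sup>+x. ennreal (k x * exp (\<eta> * S x)) \<partial>lborel)" for \<eta>
    unfolding partition_integral_def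
    by (intro nn_integral_cong) (auto simp: k_def S_def indicator_def)
  have Z0: "partition_integral D h T \<eta> \<noteq> 0" for \<eta>
  proof
    assume "partition_integral D h T \<eta> = 0"
    then have "AE x in lborel. ennreal (k x * exp (\<eta> * S x)) = 0"
      unfolding Z by (subst (asm) nn_integral_0_iff_AE) auto
    then have "AE x in lborel. x \<in> D \<longrightarrow> h x = 0"
    proof eventually_elim
      case (elim x)
      then show ?case
        using h0[of x] by (auto simp: k_def ennreal_eq_0_iff mult_le_0_iff not_le[symmetric])
    qed
    then show False using ef by (simp add: exponential_family_def)
  qed
  show ?thesis
  proof (rule that[of \<nu> S])
    show "sigma_finite_measure \<nu>"
      unfolding \<nu>_def by (subst sigma_finite_measure.sigma_finite_iff_density_finite[OF sigma_finite_lborel]) auto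
    fix \<eta> assume "\<eta> \<in> natural_parameters D h T"
    then have Zinf: "partition_integral D h T \<eta> \<noteq> \<infinity>"
      by (auto simp: natural_parameters_def log_partition_def)
    define A where "A = enn2real (partition_integral D h T \<eta>)"
    have A: "partition_integral D h T \<eta> = ennreal A" and Apos: "0 < A"
      using Zinf Z0[of \<eta>] by (auto simp: A_def less_top enn2real_positive_iff zero_less_iff_neq_zero)
    have log: "real_of_ereal (log_partition D h T \<eta>) = ln A"
      using Zinf Z0[of \<eta>] by (simp add: log_partition_def A_def)
    have eq: "ef_measure D h T \<eta> = density \<nu> (\<lambda>x. ennreal (exp (\<eta> * S x) / A))"
      unfolding ef_measure_def \<nu>_def
    proof (subst density_density_eq)
      show "density lborel (\<lambda>x. ennreal (ef_density D h T \<eta> x) * indicator D x) =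
          density lborel (\<lambda>x. ennreal (k x) * ennreal (exp (\<eta> * S x) / A))"
        using k0 Apos h0
        by (intro arg_cong[where f = "density lborel"] ext)
          (auto simp: ef_density_def log exp_diff k_def S_def indicator_def simp flip: ennreal_mult')
    qed auto
    have "emeasure (ef_measure D h T \<eta>) (space (ef_measure D h T \<eta>))
        = (\<integral>\<^sup>+x. ennreal (k x * exp (\<eta> * S x)) * ennreal (1 / A) \<partial>lborel)"
      unfolding eq \<nu>_def using Apos k0
      by (subst emeasure_density)
        (auto simp: nn_integral_density simp flip: ennreal_mult' ennreal_mult'' intro!: nn_integral_cong)
    also have "\<dots> = ennreal A * ennreal (1 / A)"
      by (subst nn_integral_multc) (auto simp: A simp flip: Z)
    also have "\<dots> = 1" using Apos by (simp flip: ennreal_mult')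
    finally have "prob_space (ef_measure D h T \<eta>)" by (rule prob_spaceI)
    with eq Apos show "\<exists>Z>0. ef_measure D h T \<eta> = density \<nu> (\<lambda>x. ennreal (exp (\<eta> * S x) / Z)) \<and>
        prob_space (ef_measure D h T \<eta>)" by blast
  qed (auto simp: \<nu>_def)
qed

text \<open>
  The product of the densities \<open>exp (\<eta> * S (x i)) / Z\<close> is \<open>exp (\<eta> * (\<Sum>i<n. S (x i))) / Z ^ n\<close>. Both the
  integrability of the exponential and the value \<open>Z ^ n\<close> of its integral then follow from the
  total mass 1 of the product.
\<close>

lemma exponential_family_product:
  assumes ef: "exponential_family D h T"
  obtains \<mu> :: "(nat \<Rightarrow> real) measure" and S where
    "sets \<mu> = sets (Pi\<^sub>M {..<n} (\<lambda>_. borel))" "S \<in> borel_measurable \<mu>"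
    "\<And>\<eta>. \<eta> \<in> natural_parameters D h T \<Longrightarrow> prob_space (Pi\<^sub>M {..<n} (\<lambda>_. ef_measure D h T \<eta>))"
    "\<And>\<eta>. \<eta> \<in> natural_parameters D h T \<Longrightarrow> integrable \<mu> (\<lambda>x. exp (\<eta> * S x))"
    "\<And>\<eta>. \<eta> \<in> natural_parameters D h T \<Longrightarrow> 0 < (\<integral>x. exp (\<eta> * S x) \<partial>\<mu>)"
    "\<And>\<eta>. \<eta> \<in> natural_parameters D h T \<Longrightarrow> Pi\<^sub>M {..<n} (\<lambda>_. ef_measure D h T \<eta>) =
      density \<mu> (\<lambda>x. ennreal (exp (\<eta> * S x) / (\<integral>x. exp (\<eta> * S x) \<partial>\<mu>)))"
proof -
  obtain \<nu> S where \<nu>: "sets \<nu> = sets borel" and S[measurable]: "S \<in> borel_measurable borel"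
    and sf: "sigma_finite_measure \<nu>"
    and fam: "\<And>\<eta>. \<eta> \<in> natural_parameters D h T \<Longrightarrow>
      \<exists>Z>0. ef_measure D h T \<eta> = density \<nu> (\<lambda>x. ennreal (exp (\<eta> * S x) / Z)) \<and>
        prob_space (ef_measure D h T \<eta>)"
    using exponential_family_wrt_carrier[OF ef] by metis
  define \<mu> where "\<mu> = Pi\<^sub>M {..<n} (\<lambda>_. \<nu>)"
  define R where "R x = (\<Sum>i<n. S (x i))" for x
  have sets_\<mu>: "sets \<mu> = sets (Pi\<^sub>M {..<n} (\<lambda>_. borel))"
    unfolding \<mu>_def using \<nu> by (intro sets_PiM_cong) auto
  have R[measurable]: "R \<in> borel_measurable \<mu>"
    unfolding R_def measurable_cong_sets[OF sets_\<mu> refl] by measurable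
  have *: "prob_space (Pi\<^sub>M {..<n} (\<lambda>_. ef_measure D h T \<eta>)) \<and>
      integrable \<mu> (\<lambda>x. exp (\<eta> * R x)) \<and> 0 < (\<integral>x. exp (\<eta> * R x) \<partial>\<mu>) \<and>
      Pi\<^sub>M {..<n} (\<lambda>_. ef_measure D h T \<eta>) =
        density \<mu> (\<lambda>x. ennreal (exp (\<eta> * R x) / (\<integral>x. exp (\<eta> * R x) \<partial>\<mu>)))"
    if \<eta>: "\<eta> \<in> natural_parameters D h T" for \<eta>
  proof -
    obtain Z where Z: "0 < Z" "ef_measure D h T \<eta> = density \<nu> (\<lambda>x. ennreal (exp (\<eta> * S x) / Z))"
      "prob_space (ef_measure D h T \<eta>)"
      using fam[OF \<eta>] by blast
    have prob: "prob_space (Pi\<^sub>M {..<n} (\<lambda>_. ef_measure D h T \<eta>))"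
      using Z(3) by (rule prob_space_PiM)
    have "Pi\<^sub>M {..<n} (\<lambda>_. ef_measure D h T \<eta>) =
        density \<mu> (\<lambda>x. \<Prod>i<n. ennreal (exp (\<eta> * S (x i)) / Z))"
      unfolding Z(2) \<mu>_def
    proof (rule PiM_density)
      show "sigma_finite_measure (density \<nu> (\<lambda>x. ennreal (exp (\<eta> * S x) / Z)))"
        using Z(2,3) by (simp add: prob_space_imp_sigma_finite)
    qed (use sf in \<open>auto simp: measurable_cong_sets[OF \<nu> refl]\<close>)
    also have "(\<lambda>x. \<Prod>i<n. ennreal (exp (\<eta> * S (x i)) / Z)) = (\<lambda>x. ennreal (exp (\<eta> * R x) / Z ^ n))"
      using Z(1) by (auto simp: prod_ennreal prod_dividef R_def exp_sum sum_distrib_left)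
    finally have dens: "Pi\<^sub>M {..<n} (\<lambda>_. ef_measure D h T \<eta>)
        = density \<mu> (\<lambda>x. ennreal (exp (\<eta> * R x) / Z ^ n))" .
    have "1 = (\<integral>\<^sup>+x. ennreal (exp (\<eta> * R x) / Z ^ n) \<partial>\<mu>)"
      using prob_space.emeasure_space_1[OF prob] unfolding dens
      by (subst (asm) emeasure_density) (auto cong: nn_integral_cong_simp)
    moreover have "(\<integral>x. exp (\<eta> * R x) / Z ^ n \<partial>\<mu>)
        = enn2real (\<integral>\<^sup>+x. ennreal (exp (\<eta> * R x) / Z ^ n) \<partial>\<mu>)"
      using Z(1) by (intro integral_eq_nn_integral) auto
    ultimately have one: "integrable \<mu> (\<lambda>x. exp (\<eta> * R x) / Z ^ n)"
      "(\<integral>x. exp (\<eta> * R x) / Z ^ n \<partial>\<mu>) = 1"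
      using Z(1) by (auto intro!: integrableI_nonneg)
    then have "integrable \<mu> (\<lambda>x. exp (\<eta> * R x) / Z ^ n * Z ^ n)" by (intro integrable_mult_left)
    moreover have "(\<integral>x. exp (\<eta> * R x) \<partial>\<mu>) = Z ^ n" using one(2) Z(1) by simp
    ultimately show ?thesis using prob dens Z(1) by simp
  qed
  show ?thesis
    by (rule that[OF sets_\<mu> R]; drule *; elim conjE; assumption)
qed

section \<open>Impossibility of pure privacy without bias\<close>

text \<open>
  An interval of infinite length contains points \<open>u\<close> of arbitrarily large modulus. The open
  interval between \<open>u\<close> and the far end of \<open>{a<..<b}\<close> consists of points of \<open>U\<close>; \<open>t\<close> is chosen at
  distance 1 from \<open>u\<close> because \<open>u\<close> itself may be an endpoint of \<open>U\<close>.
\<close>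

lemma open_interval_through:
  fixes U :: "real set"
  assumes U: "is_interval U" "emeasure lborel U = \<infinity>" and ab: "a \<in> U" "b \<in> U" "a < b"
  obtains c d t where "{c<..<d} \<subseteq> U" "{a<..<b} \<subseteq> {c<..<d}" "t \<in> {c<..<d}" "\<bar>t\<bar> > C"
proof -
  have "\<not> bounded U" using emeasure_bounded_finite[of U] U(2) by auto
  then obtain u where u: "u \<in> U" "\<bar>u\<bar> > \<bar>C\<bar> + \<bar>a\<bar> + \<bar>b\<bar> + 1"
    unfolding bounded_iff real_norm_def by (meson not_le)
  have conv: "{p<..<q} \<subseteq> U" if "p \<in> U" "q \<in> U" for p q
    using mem_is_interval_1_I[OF U(1) that] by auto
  show ?thesis
  proof (cases "0 < u")
    case True
    show ?thesis
      by (rule that[of a u "u - 1"]) (use conv[OF ab(1) u(1)] u(2) True ab(3) in auto)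
  next
    case False
    show ?thesis
      by (rule that[of u b "u + 1"]) (use conv[OF u(1) ab(2)] u(2) False ab(3) in auto)
  qed
qed

theorem theorem5p2:
  fixes D U I :: "real set" and h T :: "real \<Rightarrow> real" and \<epsilon> :: real and n :: nat
  assumes "is_interval U" and "emeasure lborel U = \<infinity>"
    and "exponential_family D h T" and "natural_parameters D h T = U"
    and "I \<subseteq> U" and "is_interval I" and "0 < emeasure lborel I"
    and "0 \<le> \<epsilon>"
  shows "\<not> (\<exists>M :: (nat \<Rightarrow> real) \<Rightarrow> real measure.
    randomized_algorithm n borel borel M \<and>
    differentially_private \<epsilon> 0 n borel borel M \<and>
    (\<forall>\<eta>\<in>I. has_mean_output n (ef_measure D h T \<eta>) M \<eta>))"
proof
  assume "\<exists>M :: (nat \<Rightarrow> real) \<Rightarrow> real measure.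
    randomized_algorithm n borel borel M \<and>
    differentially_private \<epsilon> 0 n borel borel M \<and>
    (\<forall>\<eta>\<in>I. has_mean_output n (ef_measure D h T \<eta>) M \<eta>)"
  then obtain M :: "(nat \<Rightarrow> real) \<Rightarrow> real measure" where
    alg: "randomized_algorithm n borel borel M" and
    dp: "differentially_private \<epsilon> 0 n borel borel M" and
    mean: "\<And>\<eta>. \<eta> \<in> I \<Longrightarrow> has_mean_output n (ef_measure D h T \<eta>) M \<eta>" by blast
  let ?P = "\<lambda>\<eta>. Pi\<^sub>M {..<n} (\<lambda>_. ef_measure D h T \<eta>)"
  obtain a b where ab: "a \<in> I" "b \<in> I" "a < b"
  proof (cases "\<exists>a. I \<subseteq> {a}")
    case True
    then have "emeasure lborel I = 0"
      by (metis emeasure_empty emeasure_lborel_singleton subset_singletonD)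
    with assms(7) show ?thesis by simp
  next
    case False
    then obtain p q where "p \<in> I" "q \<in> I" "p \<noteq> q" by blast
    then show ?thesis using that[of p q] that[of q p] by (cases p q rule: linorder_cases) auto
  qed
  obtain \<mu> S where sets_\<mu>: "sets \<mu> = sets (Pi\<^sub>M {..<n} (\<lambda>_. borel :: real measure))"
    and S[measurable]: "S \<in> borel_measurable \<mu>"
    and prob: "\<And>\<eta>. \<eta> \<in> U \<Longrightarrow> prob_space (?P \<eta>)"
    and intS: "\<And>\<eta>. \<eta> \<in> U \<Longrightarrow> integrable \<mu> (\<lambda>x. exp (\<eta> * S x))"
    and posS: "\<And>\<eta>. \<eta> \<in> U \<Longrightarrow> 0 < (\<integral>x. exp (\<eta> * S x) \<partial>\<mu>)"
    and dens: "\<And>\<eta>. \<eta> \<in> U \<Longrightarrow>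
      ?P \<eta> = density \<mu> (\<lambda>x. ennreal (exp (\<eta> * S x) / (\<integral>x. exp (\<eta> * S x) \<partial>\<mu>)))"
    using exponential_family_product[OF assms(3), of n] unfolding assms(4) by metis
  have sets_P: "sets (?P \<eta>) = sets (Pi\<^sub>M {..<n} (\<lambda>_. borel :: real measure))" if "\<eta> \<in> U" for \<eta>
    using dens[OF that] sets_\<mu> by simp
  have sp_\<mu>: "space \<mu> = space (Pi\<^sub>M {..<n} (\<lambda>_. borel :: real measure))"
    using sets_\<mu> by (rule sets_eq_imp_space_eq)
  have int: "integrable (?P \<eta> \<bind> M) (\<lambda>y. y)" "(\<integral>y. y \<partial>(?P \<eta> \<bind> M)) = \<eta>" if "\<eta> \<in> I" for \<eta>
    using mean[OF that] by (auto simp: has_mean_output_def output_distribution_def)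
  have aU: "a \<in> U" "b \<in> U" using ab assms(5) by auto
  obtain C where C: "\<And>x. x \<in> space \<mu> \<Longrightarrow> (\<integral>\<^sup>+y. ennreal \<bar>y\<bar> \<partial>M x) \<le> ennreal C" "0 \<le> C"
    using private_output_moment_bound[OF alg dp assms(8) prob[OF aU(1)] sets_P[OF aU(1)] int(1)[OF ab(1)]]
    unfolding sp_\<mu> by metis
  define g where "g x = (\<integral>y. y \<partial>M x)" for x
  have K: "M \<in> \<mu> \<rightarrow>\<^sub>M subprob_algebra borel"
    using alg measurable_prob_algebraD
    by (auto simp: randomized_algorithm_def measurable_cong_sets[OF sets_\<mu> refl])
  have g[measurable]: "g \<in> borel_measurable \<mu>"
    unfolding g_def using K by measurable
  have gC: "\<bar>g x\<bar> \<le> C" if x: "x \<in> space \<mu>" for x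
  proof -
    have "sets (M x) = sets borel" using x K by (rule sets_kernel[rotated])
    then have "integrable (M x) (\<lambda>y. y)"
      using C(1)[OF x] by (auto simp: integrable_iff_bounded cong: measurable_cong_sets intro: le_less_trans)
    then have "ennreal (norm (g x)) \<le> (\<integral>\<^sup>+y. ennreal (norm y) \<partial>M x)"
      unfolding g_def by (rule integral_norm_bound_ennreal)
    also have "\<dots> \<le> ennreal C" using C(1)[OF x] by simp
    finally show ?thesis using C(2) by simp
  qed
  obtain c d t where cd: "{c<..<d} \<subseteq> U" "{a<..<b} \<subseteq> {c<..<d}" "t \<in> {c<..<d}" "\<bar>t\<bar> > C"
    using open_interval_through[OF assms(1,2) aU ab(3)] by metis
  have "\<bar>t\<bar> \<le> C"
  proof (rule bounded_unbiased_estimator_imp_bounded_parameter[OF g S gC _ _ ab(3) cd(2) _ cd(3)])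
    fix s assume s: "s \<in> {a<..<b}"
    then have sI: "s \<in> I" using mem_is_interval_1_I[OF assms(6) ab(1,2)] by auto
    then have sU: "s \<in> U" using assms(5) by auto
    let ?W = "\<integral>x. exp (s * S x) \<partial>\<mu>"
    have sp: "space (?P s) = space \<mu>" using sets_P[OF sU] sets_\<mu> by (intro sets_eq_imp_space_eq) simp
    \<comment> \<open>The unbiasedness condition is rewritten as an integral with respect to \<open>\<mu>\<close>.\<close>
    have "s = (\<integral>y. y \<partial>(?P s \<bind> M))" using int(2)[OF sI] by simp
    also have "\<dots> = (\<integral>x. g x \<partial>?P s)"
      unfolding g_def
    proof (rule integral_bind_of_finite_mean[OF prob[OF sU] _ _ int(1)[OF sI]])
      show "M \<in> ?P s \<rightarrow>\<^sub>M subprob_algebra borel"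
        using K by (simp add: measurable_cong_sets[OF trans[OF sets_P[OF sU] sets_\<mu>[symmetric]] refl])
      show "(\<integral>\<^sup>+y. ennreal \<bar>y\<bar> \<partial>M x) < \<infinity>" if "x \<in> space (?P s)" for x
        using C(1)[of x] that by (auto simp: sp intro: le_less_trans)
    qed
    also have "\<dots> = (\<integral>x. g x * exp (s * S x) \<partial>\<mu>) / ?W"
      unfolding dens[OF sU] using posS[OF sU] by (subst integral_density) (auto simp: mult.commute)
    finally show "(\<integral>x. g x * exp (s * S x) \<partial>\<mu>) = s * ?W"
      using posS[OF sU] by (simp add: field_simps)
  qed (use cd(1) intS posS in auto)
  with cd(4) show False by simp
qed

end
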